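(* Let $k$ be an algebraically closed field of characteristic $p\ge3$, let $(\mathfrak{g},[p])$ be a finite-dimensional restricted Lie algebra over $k$, and let $\mathfrak{t}\subseteq\mathfrak{g}$ be a torus of maximal dimension. If $M$ is a finite-dimensional restricted $\mathfrak{g}$-module with weight space decomposition $$M=\bigoplus_{\lambda\in\Lambda_M}M_\lambda$$ relative to $\mathfrak{t}$, then $\Lambda_M\subseteq\mathrm{Lie}_p(\mathfrak{t},k)$ is $S(\mathfrak{g},\mathfrak{t})$-stable and the dimensions of the weight spaces are constant on the $S(\mathfrak{g},\mathfrak{t})$-orbits.
   Context: A torus is an abelian $p$-subalgebra consisting of semisimple elements ($x$ is semisimple if it lies in the $p$-subalgebra generated by $x^{[p]}$); "maximal dimension" means dimension $\mu(\mathfrak{g})$, the maximum of the dimensions of all tori of $\mathfrak{g}$. A $\mathfrak{g}$-module $M$ is restricted if for every $x\in\mathfrak{g}$ the element $x^{[p]}$ acts on $M$ as the $p$-th power of the action of $x$. Then $M$ is completely reducible over $\mathfrak{t}$; $M_\lambda=\{m: t.m=\lambda(t)m\ \forall t\in\mathfrak{t}\}$ and $\Lambda_M=\{\lambda: M_\lambda\ne0\}$. $\mathrm{Lie}_p(\mathfrak{t},k)$ is the additive group of homomorphisms $\mathfrak{t}\to k$ of restricted Lie algebras ($k$ with $p$-map $a\mapsto a^p$), i.e. linear forms with $\lambda(t^{[p]})=\lambda(t)^p$. The group $\mathrm{Aut}_p(\mathfrak{t})$ of automorphisms of the restricted Lie algebra $\mathfrak{t}$ acts on $\mathrm{Lie}_p(\mathfrak{t},k)$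 by $h\cdot\lambda=\lambda\circ h^{-1}$. Let $\mathcal{T}_{\mathfrak{g}}(k)$ be the (smooth affine) variety of injective homomorphisms $\mathfrak{t}\to\mathfrak{g}$ of restricted Lie algebras and $\mathcal{X}_{\mathfrak{t}}(k)$ its irreducible (equivalently, connected) component containing the inclusion. $\mathrm{Aut}_p(\mathfrak{t})$ acts on $\mathcal{T}_{\mathfrak{g}}(k)$ by $h\cdot\varphi=\varphi\circ h^{-1}$, and $S(\mathfrak{g},\mathfrak{t})=\mathrm{Stab}_{\mathrm{Aut}_p(\mathfrak{t})}(\mathcal{X}_{\mathfrak{t}}(k))\subseteq\mathrm{Aut}_p(\mathfrak{t})$. *)

theory Defs
  imports
    "HOL-Analysis.Abstract_Topology"
    "HOL-Computational_Algebra.Polynomial"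
    "HOL-Library.FuncSet"
begin

subsection \<open>Restricted Lie algebras\<close>

text \<open>
  A (restricted) Lie algebra lives on a whole type \<open>'g\<close>, as in \<^theory>\<open>HOL.Vector_Spaces\<close>;
  subalgebras are sets, and linear maps out of a subalgebra \<open>S\<close> are functions in
  \<^const>\<open>extensional\<close> \<open>S\<close>, so that two of them are equal as soon as they agree on \<open>S\<close>.
\<close>

record ('k, 'g) rlie =
  scl :: "'k \<Rightarrow> 'g \<Rightarrow> 'g"
  brk :: "'g \<Rightarrow> 'g \<Rightarrow> 'g"
  pmap :: "'g \<Rightarrow> 'g"

text \<open>
  Polynomials with coefficients in \<open>'g\<close> represent \<open>\<gg> \<otimes> k[X]\<close>; \<open>ad_poly g x y\<close> is
  \<open>ad (x \<otimes> X + y \<otimes> 1)\<close>, where multiplication by \<open>X\<close> is \<open>pCons 0\<close>.  The elements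
  \<open>s\<^sub>i(x,y)\<close> are determined by
  \<open>(ad (x \<otimes> X + y \<otimes> 1))^(p-1) (x \<otimes> 1) = (\<Sum>i=1..p-1. i s\<^sub>i(x,y) \<otimes> X^(i-1))\<close>.
\<close>

definition ad_poly :: "('k, 'g::ab_group_add) rlie \<Rightarrow> 'g \<Rightarrow> 'g \<Rightarrow> 'g poly \<Rightarrow> 'g poly" where
  "ad_poly g x y q = pCons 0 (map_poly (brk g x) q) + map_poly (brk g y) q"

definition jacobson_s :: "('k::field, 'g::ab_group_add) rlie \<Rightarrow> nat \<Rightarrow> 'g \<Rightarrow> 'g \<Rightarrow> 'g" where
  "jacobson_s g i x y =
     scl g (inverse (of_nat i)) (coeff ((ad_poly g x y ^^ (CHAR('k) - 1)) [:x:]) (i - 1))"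

definition restricted_lie_algebra :: "('k::field, 'g::ab_group_add) rlie \<Rightarrow> bool" where
  "restricted_lie_algebra g \<longleftrightarrow>
     vector_space (scl g) \<and>
     (\<forall>x. Vector_Spaces.linear (scl g) (scl g) (\<lambda>y. brk g x y)) \<and>
     (\<forall>y. Vector_Spaces.linear (scl g) (scl g) (\<lambda>x. brk g x y)) \<and>
     (\<forall>x. brk g x x = 0) \<and>
     (\<forall>x y z. brk g x (brk g y z) + brk g y (brk g z x) + brk g z (brk g x y) = 0) \<and>
     (\<forall>x y. brk g (pmap g x) y = (brk g x ^^ CHAR('k)) y) \<and>
     (\<forall>c x. pmap g (scl g c x) = scl g (c ^ CHAR('k)) (pmap g x)) \<and>
     (\<forall>x y. pmap g (x + y) =
        pmap g x + pmap g y + (\<Sum>i = 1..CHAR('k) - 1. jacobson_s g i x y))"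

text \<open>The field itself, as an abelian restricted Lie algebra with \<open>p\<close>-map \<open>a \<mapsto> a\<^sup>p\<close>.\<close>

definition field_rlie :: "('k::field, 'k) rlie" where
  "field_rlie = \<lparr>scl = (*), brk = (\<lambda>_ _. 0), pmap = (\<lambda>a. a ^ CHAR('k))\<rparr>"

subsection \<open>Tori\<close>

definition p_subalgebra :: "('k::field, 'g::ab_group_add) rlie \<Rightarrow> 'g set \<Rightarrow> bool" where
  "p_subalgebra g S \<longleftrightarrow>
     module.subspace (scl g) S \<and> (\<forall>x\<in>S. \<forall>y\<in>S. brk g x y \<in> S) \<and> (\<forall>x\<in>S. pmap g x \<in> S)"

definition semisimple :: "('k::field, 'g::ab_group_add) rlie \<Rightarrow> 'g \<Rightarrow> bool" where
  "semisimple g x \<longleftrightarrow> x \<in> p_subalgebra g hull {pmap g x}"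

definition torus :: "('k::field, 'g::ab_group_add) rlie \<Rightarrow> 'g set \<Rightarrow> bool" where
  "torus g t \<longleftrightarrow>
     p_subalgebra g t \<and> (\<forall>x\<in>t. \<forall>y\<in>t. brk g x y = 0) \<and> (\<forall>x\<in>t. semisimple g x)"

definition max_torus_dim :: "('k::field, 'g::ab_group_add) rlie \<Rightarrow> nat" where
  "max_torus_dim g = Max {vector_space.dim (scl g) t | t. torus g t}"

subsection \<open>Homomorphisms, automorphisms and the variety of embeddings\<close>

definition linear_maps_on ::
  "('k::field, 'a::ab_group_add) rlie \<Rightarrow> 'a set \<Rightarrow> ('k, 'b::ab_group_add) rlie \<Rightarrow> ('a \<Rightarrow> 'b) set" where
  "linear_maps_on A S B =
     {f \<in> extensional S.
        (\<forall>x\<in>S. \<forall>y\<in>S. f (x + y) = f x + f y) \<and> (\<forall>c. \<forall>x\<in>S. f (scl A c x) = scl B c (f x))}"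

definition rlie_homs ::
  "('k::field, 'a::ab_group_add) rlie \<Rightarrow> 'a set \<Rightarrow> ('k, 'b::ab_group_add) rlie \<Rightarrow> ('a \<Rightarrow> 'b) set" where
  "rlie_homs A S B =
     {f \<in> linear_maps_on A S B.
        (\<forall>x\<in>S. \<forall>y\<in>S. f (brk A x y) = brk B (f x) (f y)) \<and>
        (\<forall>x\<in>S. f (pmap A x) = pmap B (f x))}"

definition toral_forms :: "('k::field, 'g::ab_group_add) rlie \<Rightarrow> 'g set \<Rightarrow> ('g \<Rightarrow> 'k) set" where
  "toral_forms g t = rlie_homs g t field_rlie"

definition rlie_auts :: "('k::field, 'g::ab_group_add) rlie \<Rightarrow> 'g set \<Rightarrow> ('g \<Rightarrow> 'g) set" where
  "rlie_auts g t = {h \<in> rlie_homs g t g. bij_betw h t t}"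

definition embeddings :: "('k::field, 'g::ab_group_add) rlie \<Rightarrow> 'g set \<Rightarrow> ('g \<Rightarrow> 'g) set" where
  "embeddings g t = {\<phi> \<in> rlie_homs g t g. inj_on \<phi> t}"

definition inclusion :: "'g set \<Rightarrow> 'g \<Rightarrow> 'g" where
  "inclusion t = (\<lambda>x\<in>t. x)"

text \<open>The action \<open>h \<cdot> f = f \<circ> h\<inverse>\<close>, on linear forms as well as on embeddings.\<close>

definition aut_act :: "'g set \<Rightarrow> ('g \<Rightarrow> 'g) \<Rightarrow> ('g \<Rightarrow> 'b) \<Rightarrow> 'g \<Rightarrow> 'b" where
  "aut_act t h f = (\<lambda>x\<in>t. f (inv_into t h x))"

subsection \<open>The Zariski topology on the variety of embeddings\<close>

text \<open>
  The polynomial functions on the affine space \<open>Hom\<^sub>k(t, \<gg>)\<close>: the \<open>k\<close>-algebra generated by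
  the matrix coefficients \<open>\<phi> \<mapsto> \<xi> (\<phi> x)\<close>, which span the dual space of \<open>Hom\<^sub>k(t, \<gg>)\<close>.
\<close>

inductive_set hom_polys ::
  "('k::field, 'g::ab_group_add) rlie \<Rightarrow> 'g set \<Rightarrow> (('g \<Rightarrow> 'g) \<Rightarrow> 'k) set"
  for g t where
  const: "(\<lambda>\<phi>. c) \<in> hom_polys g t"
| coord: "x \<in> t \<Longrightarrow> Vector_Spaces.linear (scl g) (*) \<xi> \<Longrightarrow> (\<lambda>\<phi>. \<xi> (\<phi> x)) \<in> hom_polys g t"
| add: "f \<in> hom_polys g t \<Longrightarrow> f' \<in> hom_polys g t \<Longrightarrow> (\<lambda>\<phi>. f \<phi> + f' \<phi>) \<in> hom_polys g t"
| mult: "f \<in> hom_polys g t \<Longrightarrow> f' \<in> hom_polys g t \<Longrightarrow> (\<lambda>\<phi>. f \<phi> * f' \<phi>) \<in> hom_polys g t"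

definition zariski :: "('k::field, 'g::ab_group_add) rlie \<Rightarrow> 'g set \<Rightarrow> ('g \<Rightarrow> 'g) topology" where
  "zariski g t = topology (\<lambda>U. \<exists>F \<subseteq> hom_polys g t. U = {\<phi> \<in> embeddings g t. \<exists>f\<in>F. f \<phi> \<noteq> 0})"

lemma openin_zariski:
  fixes g :: "('k::field, 'g::ab_group_add) rlie"
  shows "openin (zariski g t) U \<longleftrightarrow>
     (\<exists>F \<subseteq> hom_polys g t. U = {\<phi> \<in> embeddings g t. \<exists>f\<in>F. f \<phi> \<noteq> 0})"
proof -
  let ?D = "\<lambda>F :: (('g \<Rightarrow> 'g) \<Rightarrow> 'k) set. {\<phi> \<in> embeddings g t. \<exists>f\<in>F. f \<phi> \<noteq> 0}"
  let ?L = "\<lambda>U. \<exists>F \<subseteq> hom_polys g t. U = ?D F"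
  have "istopology ?L"
    unfolding istopology_def
  proof (intro conjI allI impI)
    fix S T assume "?L S" "?L T"
    then obtain F G where F: "F \<subseteq> hom_polys g t" "S = ?D F" and G: "G \<subseteq> hom_polys g t" "T = ?D G"
      by auto
    let ?H = "{\<lambda>\<phi>. f \<phi> * f' \<phi> | f f'. f \<in> F \<and> f' \<in> G}"
    have "?H \<subseteq> hom_polys g t"
      using F(1) G(1) by (auto intro: hom_polys.mult)
    moreover have "S \<inter> T = ?D ?H"
    proof
      show "S \<inter> T \<subseteq> ?D ?H"
      proof
        fix \<phi> assume "\<phi> \<in> S \<inter> T"
        then obtain f f' where *: "\<phi> \<in> embeddings g t" "f \<in> F" "f' \<in> G" "f \<phi> \<noteq> 0" "f' \<phi> \<noteq> 0"
          unfolding F(2) G(2) by blast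
        have H: "(\<lambda>\<phi>. f \<phi> * f' \<phi>) \<in> ?H" and nz: "f \<phi> * f' \<phi> \<noteq> 0"
          using * by auto
        have "\<exists>h\<in>?H. h \<phi> \<noteq> 0"
          by (rule bexI[OF _ H]) (rule nz)
        with *(1) show "\<phi> \<in> ?D ?H"
          by (intro CollectI conjI)
      qed
      show "?D ?H \<subseteq> S \<inter> T"
        unfolding F(2) G(2) by auto
    qed
    ultimately show "?L (S \<inter> T)"
      by blast
  next
    fix K assume K: "\<forall>U\<in>K. ?L U"
    let ?H = "\<Union>{F. F \<subseteq> hom_polys g t \<and> ?D F \<in> K}"
    have "\<Union>K = ?D ?H"
    proof
      show "\<Union>K \<subseteq> ?D ?H"
      proof
        fix \<phi> assume "\<phi> \<in> \<Union>K"
        then obtain U where U: "U \<in> K" "\<phi> \<in> U"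
          by blast
        then obtain F where F: "F \<subseteq> hom_polys g t" "U = ?D F"
          using K by blast
        with U obtain f where f: "\<phi> \<in> embeddings g t" "f \<in> F" "f \<phi> \<noteq> 0"
          by blast
        have "f \<in> ?H"
          using f F U(1) by (intro UnionI[of F]) simp_all
        with f show "\<phi> \<in> ?D ?H"
          by (intro CollectI conjI bexI[of _ f])
      qed
      show "?D ?H \<subseteq> \<Union>K"
      proof
        fix \<phi> assume "\<phi> \<in> ?D ?H"
        then obtain F f where f: "\<phi> \<in> embeddings g t" "f \<in> F" "f \<phi> \<noteq> 0" and F: "?D F \<in> K"
          by blast
        then have "\<phi> \<in> ?D F"
          by (intro CollectI conjI bexI[of _ f])
        with F show "\<phi> \<in> \<Union>K"
          by (rule UnionI)
      qed
    qed
    moreover have "?H \<subseteq> hom_polys g t"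
      by (rule Union_least) simp
    ultimately show "?L (\<Union>K)"
      by blast
  qed
  then show ?thesis
    unfolding zariski_def by simp
qed

lemma topspace_zariski: "topspace (zariski g t) = embeddings g t"
proof
  show "topspace (zariski g t) \<subseteq> embeddings g t"
    unfolding topspace_def by (auto simp: openin_zariski)
  have "openin (zariski g t) (embeddings g t)"
    unfolding openin_zariski
    by (intro exI[of _ "{\<lambda>\<phi>. 1}"]) (auto intro: hom_polys.const)
  then show "embeddings g t \<subseteq> topspace (zariski g t)"
    by (rule openin_subset)
qed

lemma closedin_zariski:
  fixes g :: "('k::field, 'g::ab_group_add) rlie"
  shows "closedin (zariski g t) C \<longleftrightarrow>
     (\<exists>F \<subseteq> hom_polys g t. C = {\<phi> \<in> embeddings g t. \<forall>f\<in>F. f \<phi> = 0})"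
proof -
  have *: "C \<subseteq> embeddings g t \<and>
      embeddings g t - C = {\<phi> \<in> embeddings g t. \<exists>f\<in>F. f \<phi> \<noteq> 0} \<longleftrightarrow>
      C = {\<phi> \<in> embeddings g t. \<forall>f\<in>F. f \<phi> = 0}" for F :: "(('g \<Rightarrow> 'g) \<Rightarrow> 'k) set"
    by blast
  show ?thesis
    unfolding closedin_def topspace_zariski openin_zariski *[symmetric] by blast
qed

definition irreducible_subset :: "'a topology \<Rightarrow> 'a set \<Rightarrow> bool" where
  "irreducible_subset X S \<longleftrightarrow>
     S \<subseteq> topspace X \<and> S \<noteq> {} \<and>
     (\<forall>A B. closedin X A \<and> closedin X B \<and> S \<subseteq> A \<union> B \<longrightarrow> S \<subseteq> A \<or> S \<subseteq> B)"

definition irreducible_component :: "'a topology \<Rightarrow> 'a set \<Rightarrow> bool" where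
  "irreducible_component X C \<longleftrightarrow>
     irreducible_subset X C \<and> (\<forall>D. irreducible_subset X D \<and> C \<subseteq> D \<longrightarrow> D = C)"

definition component_stabilizer ::
  "('k::field, 'g::ab_group_add) rlie \<Rightarrow> 'g set \<Rightarrow> ('g \<Rightarrow> 'g) set \<Rightarrow> ('g \<Rightarrow> 'g) set" where
  "component_stabilizer g t X = {h \<in> rlie_auts g t. aut_act t h ` X = X}"

subsection \<open>Restricted modules and weights\<close>

definition restricted_module ::
  "('k::field, 'g::ab_group_add) rlie \<Rightarrow> ('k \<Rightarrow> 'm \<Rightarrow> 'm::ab_group_add) \<Rightarrow> ('g \<Rightarrow> 'm \<Rightarrow> 'm) \<Rightarrow> bool" where
  "restricted_module g sM act \<longleftrightarrow>
     vector_space sM \<and>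
     (\<forall>x. Vector_Spaces.linear sM sM (\<lambda>m. act x m)) \<and>
     (\<forall>m. Vector_Spaces.linear (scl g) sM (\<lambda>x. act x m)) \<and>
     (\<forall>x y m. act (brk g x y) m = act x (act y m) - act y (act x m)) \<and>
     (\<forall>x m. act (pmap g x) m = (act x ^^ CHAR('k)) m)"

definition weight_space ::
  "('k \<Rightarrow> 'm \<Rightarrow> 'm) \<Rightarrow> ('g \<Rightarrow> 'm \<Rightarrow> 'm) \<Rightarrow> 'g set \<Rightarrow> ('g \<Rightarrow> 'k) \<Rightarrow> 'm set" where
  "weight_space sM act t \<mu> = {m. \<forall>x\<in>t. act x m = sM (\<mu> x) m}"

definition weights ::
  "('k::field, 'g::ab_group_add) rlie \<Rightarrow> ('k \<Rightarrow> 'm \<Rightarrow> 'm::ab_group_add) \<Rightarrow> ('g \<Rightarrow> 'm \<Rightarrow> 'm) \<Rightarrow>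
     'g set \<Rightarrow> ('g \<Rightarrow> 'k) set" where
  "weights g sM act t =
     {\<mu> \<in> linear_maps_on g t field_rlie. weight_space sM act t \<mu> \<noteq> {0}}"

text \<open>
  The module is the direct sum of the \<open>W i\<close>.  Finiteness of the index set is required
  because \<^const>\<open>sum\<close> is zero over infinite sets.
\<close>

definition is_direct_sum :: "'i set \<Rightarrow> ('i \<Rightarrow> 'm::ab_group_add set) \<Rightarrow> bool" where
  "is_direct_sum I W \<longleftrightarrow> finite I \<and> (\<forall>m. \<exists>!f. f \<in> Pi\<^sub>E I W \<and> m = sum f I)"

end

theory Submission
  imports Defs "Jordan_Normal_Form.Determinant"
begin

text \<open>
  The weight spaces of \<open>M\<close> can be taken along any embedding \<open>\<phi> : t \<rightarrow> g\<close>, by letting \<open>x \<in> t\<close> act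
  as \<open>\<phi> x\<close>.  The theorem holds because the multiplicity of a fixed linear form \<open>\<mu>\<close> does not change
  while \<open>\<phi>\<close> moves in an irreducible set of embeddings (\<open>dim_weight_space_constant\<close>).  If \<open>h\<close> stabilizes
  the component \<open>X\<close> of the inclusion, then \<open>X\<close> also contains \<open>h \<cdot> inclusion\<close>, along which \<open>x\<close> acts as
  \<open>h\<inverse> x\<close>; the weight space of \<open>\<mu> \<circ> h\<inverse>\<close> along this embedding is the weight space of \<open>\<mu>\<close>
  along the inclusion.  So \<open>\<mu>\<close> and \<open>\<mu> \<circ> h\<inverse>\<close> have the same multiplicity in \<open>M\<close>.
  
  To see that the multiplicity is constant, it is turned into the value of a regular function.  A trace
  would only record it modulo the characteristic, so a determinant is used.  Let \<open>P\<^sub>\<phi>\<close> be the projector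
  onto the weight space of \<open>\<mu>\<close> along \<open>\<phi>\<close>.  Then \<open>det (1 + (c - 1) P\<^sub>\<phi>) = c\<^sup>d\<close> where \<open>d\<close> is the
  multiplicity (\<open>op_det_weight_stretch\<close>), and \<open>c\<close> can be chosen such that its powers up to the dimension
  of \<open>M\<close> are distinct.  A regular function with finitely many values on an irreducible set is constant
  there (\<open>regular_function_constant_on_irreducible\<close>), hence so is \<open>d\<close>.
  
  For this function to be regular in \<open>\<phi>\<close>, the projector must be given by one polynomial formula for all
  \<open>\<phi>\<close>.  Semisimplicity provides it: \<open>x \<in> t\<close> lies in the \<open>p\<close>-subalgebra generated by its \<open>p\<close>-th power, so
  \<open>x\<close> acts along every \<open>\<phi>\<close> as \<open>q\<close> of itself for a polynomial \<open>q\<close> with zero derivative that depends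
  only on \<open>x\<close> (\<open>separable_annihilator\<close>).  The polynomial \<open>X - q\<close> has derivative 1, hence no multiple
  root; it makes the action diagonalizable, with eigenvalues in a finite set independent of \<open>\<phi>\<close>, and
  Lagrange interpolation on this set yields the projectors.  Simultaneous diagonalization over a
  spanning list of \<open>t\<close> also gives the weight space decomposition.
\<close>

section \<open>Separable polynomials over an algebraically closed field\<close>

text \<open>
  If the field were finite, the product of all \<open>X - a\<close>, increased by 1, would have no root.
\<close>

lemma infinite_alg_closed_field: "infinite (UNIV :: 'k::alg_closed_field set)"
proof
  assume fin: "finite (UNIV :: 'k set)"
  define q :: "'k poly" where "q = (\<Prod>a\<in>UNIV. [:- a, 1:])"
  have deg: "degree q = card (UNIV :: 'k set)"
    unfolding q_def by (subst degree_prod_eq_sum_degree) auto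
  moreover have "card (UNIV :: 'k set) > 0"
    using fin by (simp add: card_gt_0_iff)
  ultimately have "degree (q + 1) > 0"
    by (subst degree_add_eq_left) auto
  then obtain x where "poly (q + 1) x = 0"
    using alg_closed_imp_poly_has_root by blast
  moreover have "poly q x = 0"
    unfolding q_def using fin by (subst poly_prod, intro prod_zero) auto
  ultimately show False
    by simp
qed

text \<open>
  Two equal powers of \<open>c\<close> would make \<open>c\<close> zero or a root of unity of bounded order, and there are only
  finitely many of these.
\<close>

lemma exists_injective_powers:
  "\<exists>c :: 'k::alg_closed_field. inj_on (\<lambda>i. c ^ i) {..n}"
proof -
  define Z where "Z = (\<Union>j\<in>{1..n}. {c :: 'k. poly (monom 1 j - 1) c = 0})"
  have "monom (1::'k) j - 1 \<noteq> 0" if "j \<ge> 1" for j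
    using that by (metis degree_1 degree_monom_eq eq_iff_diff_eq_0 not_one_le_zero one_neq_zero)
  then have "finite Z"
    unfolding Z_def by (intro finite_UN_I poly_roots_finite) auto
  then obtain c where c: "c \<notin> insert 0 Z"
    using ex_new_if_finite[OF infinite_alg_closed_field] by (metis finite_insert)
  have "c ^ i \<noteq> c ^ j" if "i < j" "j \<le> n" for i j
  proof
    assume eq: "c ^ i = c ^ j"
    have "c ^ j = c ^ i * c ^ (j - i)"
      using that by (simp add: power_add[symmetric])
    with eq c have "c ^ (j - i) = 1"
      by auto
    then have "c \<in> Z"
      unfolding Z_def using that by (intro UN_I[of "j - i"]) (auto simp: poly_monom)
    with c show False
      by simp
  qed
  then have "inj_on (\<lambda>i. c ^ i) {..n}"
    by (intro linorder_inj_onI) auto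
  then show ?thesis ..
qed

text \<open>
  Coprimality with the derivative, expressed by the absence of multiple roots in the field itself; this
  is the classical notion when the field is algebraically closed.
\<close>

definition separable :: "'k::field poly \<Rightarrow> bool" where
  "separable q \<longleftrightarrow> (\<forall>a. poly q a = 0 \<longrightarrow> poly (pderiv q) a \<noteq> 0)"

lemma separable_cofactor:
  fixes r :: "'k::field poly"
  assumes q: "q = [:- b, 1:] * r" "separable q"
  shows "poly r b \<noteq> 0" "separable r"
proof -
  have val: "poly q a = (a - b) * poly r a" for a
    by (simp add: q(1) del: mult_pCons_left)
  have der: "poly (pderiv q) a = poly r a + (a - b) * poly (pderiv r) a" for a
    by (simp add: q(1) pderiv_mult pderiv_pCons del: mult_pCons_left mult_pCons_right)
  show "poly r b \<noteq> 0"
    using q(2) val[of b] der[of b] unfolding separable_def by force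
  show "separable r"
    unfolding separable_def
  proof (intro allI impI)
    fix a assume "poly r a = 0"
    then have "poly q a = 0" "poly (pderiv q) a = (a - b) * poly (pderiv r) a"
      unfolding val der by simp_all
    with q(2) show "poly (pderiv r) a \<noteq> 0"
      unfolding separable_def by force
  qed
qed

section \<open>Polynomials in an operator and simultaneous eigenvectors\<close>

locale alg_closed_vector_space = finite_dimensional_vector_space scale Basis
  for scale :: "'k::alg_closed_field \<Rightarrow> 'm::ab_group_add \<Rightarrow> 'm" (infixr "*s" 75)
    and Basis
begin

sublocale pair: vector_space_pair scale scale ..

abbreviation endo :: "('m \<Rightarrow> 'm) \<Rightarrow> bool" where
  "endo \<equiv> Vector_Spaces.linear (*s) (*s)"

lemma endoI:
  assumes "\<And>x y. A (x + y) = A x + A y" "\<And>c x. A (c *s x) = c *s A x"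
  shows "endo A"
  using assms vector_space_axioms by (simp add: Vector_Spaces.linear_iff)


definition operator_poly :: "'k poly \<Rightarrow> ('m \<Rightarrow> 'm) \<Rightarrow> 'm \<Rightarrow> 'm" where
  "operator_poly q A m = fold_coeffs (\<lambda>a v. a *s m + A v) q 0"

lemma operator_poly_0 [simp]: "operator_poly 0 A m = 0"
  by (simp add: operator_poly_def)

lemma operator_poly_pCons:
  assumes "endo A"
  shows "operator_poly (pCons a q) A m = a *s m + A (operator_poly q A m)"
  using pair.linear_0[OF assms]
  by (cases "q = 0 \<and> a = 0") (auto simp: operator_poly_def)

lemma operator_poly_add:
  assumes "endo A"
  shows "operator_poly (q + r) A m = operator_poly q A m + operator_poly r A m"
  by (induction q r rule: poly_induct2)
    (simp_all add: operator_poly_pCons assms pair.linear_add[OF assms] scale_left_distrib)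

lemma operator_poly_smult:
  assumes "endo A"
  shows "operator_poly (Polynomial.smult c q) A m = c *s operator_poly q A m"
  by (induction q)
    (simp_all add: operator_poly_pCons assms pair.linear_scale[OF assms] scale_right_distrib)

lemma operator_poly_diff:
  assumes "endo A"
  shows "operator_poly (q - r) A m = operator_poly q A m - operator_poly r A m"
  using operator_poly_add[OF assms, of "q - r" r] by (simp add: algebra_simps)

lemma operator_poly_mult:
  assumes "endo A"
  shows "operator_poly (q * r) A m = operator_poly q A (operator_poly r A m)"
  by (induction q)
    (simp_all add: operator_poly_pCons operator_poly_add operator_poly_smult assms)

lemma operator_poly_power:
  assumes "endo A"
  shows "operator_poly (q ^ n) A m = (operator_poly q A ^^ n) m"
  by (induction n)
    (simp_all add: operator_poly_mult operator_poly_pCons assms one_pCons pair.linear_0[OF assms])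

lemma operator_poly_X:
  assumes "endo A"
  shows "operator_poly [:0, 1:] A m = A m"
  by (simp add: operator_poly_pCons assms pair.linear_0[OF assms])

lemma linear_operator_poly:
  assumes "endo A"
  shows "endo (operator_poly q A)"
proof (rule endoI)
  show "operator_poly q A (x + y) = operator_poly q A x + operator_poly q A y" for x y
    by (induction q) (simp_all add: operator_poly_pCons assms pair.linear_add[OF assms] scale_right_distrib)
  show "operator_poly q A (c *s x) = c *s operator_poly q A x" for c x
    by (induction q)
      (simp_all add: operator_poly_pCons assms pair.linear_scale[OF assms] scale_right_distrib mult.commute)
qed

lemma operator_poly_eigenvector:
  assumes "endo A" "A m = a *s m"
  shows "operator_poly q A m = poly q a *s m"
  by (induction q)
    (simp_all add: operator_poly_pCons assms pair.linear_scale[OF assms(1)] scale_left_distrib mult.commute)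


text \<open>
  Induction on the degree: split off a root \<open>b\<close> of \<open>q\<close>.  The cofactor annihilates \<open>(A - b) m\<close>, which is
  therefore a sum of eigenvectors for roots other than \<open>b\<close>.  On these \<open>A - b\<close> is invertible, so
  \<open>(A - b) m = (A - b) u\<close> with \<open>u\<close> a sum of such eigenvectors, and \<open>m - u\<close> is an eigenvector for \<open>b\<close>.
  The invariant subspace \<open>W\<close> makes the decomposition compatible with operators commuting with \<open>A\<close>.
\<close>

lemma eigenvector_decomposition:
  assumes A: "endo A" and W: "subspace W" "A ` W \<subseteq> W"
    and q: "separable q" and m: "m \<in> W" "operator_poly q A m = 0"
  shows "m \<in> span {w \<in> W. \<exists>a. poly q a = 0 \<and> A w = a *s w}"
  using q m
proof (induction "degree q" arbitrary: q m)
  case 0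
  then obtain c where c: "q = [:c:]"
    by (metis degree_eq_zeroE)
  with 0 have "c \<noteq> 0"
    by (auto simp: separable_def)
  with 0 c have "m = 0"
    by (simp add: operator_poly_pCons A pair.linear_0[OF A])
  then show ?case
    by (simp add: span_zero)
next
  case (Suc n)
  then obtain b where "poly q b = 0"
    using alg_closed_imp_poly_has_root[of q] by auto
  then obtain r where r: "q = [:- b, 1:] * r"
    by (metis dvdE poly_eq_0_iff_dvd)
  have sep: "poly r b \<noteq> 0" "separable r"
    using separable_cofactor[OF r Suc.prems(1)] by simp_all
  have deg: "degree r = n"
    using Suc.hyps(2) sep(1) unfolding r by (subst (asm) degree_mult_eq) auto
  let ?E = "\<lambda>q. {w \<in> W. \<exists>a. poly q a = 0 \<and> A w = a *s w}"
  let ?m = "A m - b *s m"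
  have "?m \<in> W"
    using W Suc.prems(2) by (auto intro!: subspace_diff subspace_scale)
  moreover have "operator_poly r A ?m = 0"
  proof -
    have "operator_poly r A (operator_poly [:- b, 1:] A m) = operator_poly q A m"
      unfolding r by (simp only: mult.commute[of _ r] operator_poly_mult[OF A])
    then show ?thesis
      using Suc.prems(3) by (simp add: operator_poly_pCons A pair.linear_0[OF A])
  qed
  ultimately have "?m \<in> span (?E r)"
    using Suc.hyps(1)[of r] deg sep(2) by simp
  (* the eigenvalue of w differs from the simple root b, so w is a multiple of A w - b w *)
  moreover have "span (?E r) \<subseteq> (\<lambda>u. A u - b *s u) ` span (?E r)"
  proof (rule span_minimal)
    show "?E r \<subseteq> (\<lambda>u. A u - b *s u) ` span (?E r)"
    proof
      fix w assume w: "w \<in> ?E r"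
      then obtain a where a: "poly r a = 0" "A w = a *s w"
        by blast
      with sep(1) have "a - b \<noteq> 0"
        by auto
      let ?u = "inverse (a - b) *s w"
      have "A ?u - b *s ?u = (inverse (a - b) * a) *s w - (b * inverse (a - b)) *s w"
        by (simp add: pair.linear_scale[OF A] a(2))
      also have "\<dots> = (inverse (a - b) * (a - b)) *s w"
        by (simp only: scale_left_diff_distrib right_diff_distrib mult.commute[of b])
      also have "\<dots> = w"
        using \<open>a - b \<noteq> 0\<close> by simp
      finally have "w = A ?u - b *s ?u" ..
      then show "w \<in> (\<lambda>u. A u - b *s u) ` span (?E r)"
        by (rule image_eqI) (intro span_scale span_base w)
    qed
    show "subspace ((\<lambda>u. A u - b *s u) ` span (?E r))"
      by (intro pair.linear_subspace_image pair.linear_compose_sub A linear_scale_self subspace_span)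
  qed
  ultimately obtain u where u: "u \<in> span (?E r)" "?m = A u - b *s u"
    by blast
  have sub: "span (?E r) \<subseteq> span (?E q)"
    by (rule span_mono) (auto simp: r)
  have "m - u \<in> ?E q"
  proof (intro CollectI conjI exI)
    have "span (?E r) \<subseteq> W"
      using W(1) by (intro span_minimal) auto
    then show "m - u \<in> W"
      using W(1) u(1) Suc.prems(2) by (auto intro: subspace_diff)
    show "A (m - u) = b *s (m - u)"
      using u(2) by (simp add: pair.linear_diff[OF A] scale_right_diff_distrib algebra_simps)
    show "poly q b = 0" by (simp add: r)
  qed
  then have "(m - u) + u \<in> span (?E q)"
    using sub u(1) by (intro span_add) (auto intro: span_base)
  then show ?case by simp
qed

text \<open>
  Each new operator preserves the simultaneous eigenspaces of the previous ones, because it commutes with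
  them, and is diagonalizable there by \<open>eigenvector_decomposition\<close>.
\<close>

lemma simultaneous_eigenvectors_span:
  assumes "finite S"
    and A: "\<And>x. x \<in> S \<Longrightarrow> endo (A x)"
    and comm: "\<And>x y m. x \<in> S \<Longrightarrow> y \<in> S \<Longrightarrow> A x (A y m) = A y (A x m)"
    and q: "\<And>x. x \<in> S \<Longrightarrow> \<exists>q. separable q \<and> (\<forall>m. operator_poly q (A x) m = 0)"
  shows "span {m. \<forall>x\<in>S. \<exists>a. A x m = a *s m} = UNIV"
  using assms
proof (induction S)
  case empty
  then show ?case by simp
next
  case (insert y S)
  let ?E = "\<lambda>S. {m. \<forall>x\<in>S. \<exists>a. A x m = a *s m}"
  have Ay: "endo (A y)" and AS: "\<And>x. x \<in> S \<Longrightarrow> endo (A x)"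
    using insert.prems(1) by auto
  obtain q where q: "separable q" "\<And>m. operator_poly q (A y) m = 0"
    using insert.prems(3) by blast
  have "?E S \<subseteq> span (?E (insert y S))"
  proof
    fix m assume "m \<in> ?E S"
    then obtain \<nu> where \<nu>: "\<And>x. x \<in> S \<Longrightarrow> A x m = \<nu> x *s m"
      by simp metis
    let ?W = "{w. \<forall>x\<in>S. A x w = \<nu> x *s w}"
    have "subspace ?W"
      by (rule subspaceI)
        (auto simp: pair.linear_0[OF AS] pair.linear_add[OF AS]
          pair.linear_scale[OF AS] scale_right_distrib mult.commute)
    moreover have "A y ` ?W \<subseteq> ?W"
    proof (rule image_subsetI, rule CollectI, rule ballI)
      fix w x assume w: "w \<in> ?W" and x: "x \<in> S"
      have "A x (A y w) = A y (A x w)"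
        using x by (intro insert.prems(2)) auto
      also have "A x w = \<nu> x *s w"
        using w x by blast
      finally show "A x (A y w) = \<nu> x *s A y w"
        by (simp only: pair.linear_scale[OF Ay])
    qed
    ultimately have "m \<in> span {w \<in> ?W. \<exists>a. poly q a = 0 \<and> A y w = a *s w}"
      using \<nu> by (intro eigenvector_decomposition[OF Ay _ _ q(1) _ q(2)]) auto
    moreover have "{w \<in> ?W. \<exists>a. poly q a = 0 \<and> A y w = a *s w} \<subseteq> ?E (insert y S)"
      by auto
    ultimately show "m \<in> span (?E (insert y S))"
      using span_mono by blast
  qed
  then have "span (?E S) \<subseteq> span (?E (insert y S))"
    by (rule span_minimal) (rule subspace_span)
  moreover have "span (?E S) = UNIV"
    using insert.IH insert.prems by simp
  ultimately show ?case
    by (intro equalityI) simp_all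
qed


section \<open>Determinants of operators\<close>

definition basis_vec :: "nat \<Rightarrow> 'm" where
  "basis_vec = from_nat_into Basis"

definition coord :: "nat \<Rightarrow> 'm \<Rightarrow> 'k" where
  "coord i v = representation Basis v (basis_vec i)"

lemma bij_basis_vec: "bij_betw basis_vec {..<dimension} Basis"
  unfolding basis_vec_def dimension_def by (rule bij_betw_from_nat_into_finite[OF finite_Basis])

lemma linear_coord: "Vector_Spaces.linear (*s) (*) (coord i)"
  unfolding coord_def by (rule linear_representation[OF independent_Basis span_Basis])

lemma coord_add: "coord i (v + w) = coord i v + coord i w"
  and coord_scale: "coord i (c *s v) = c * coord i v"
  using linear_coord by (simp_all add: Vector_Spaces.linear_iff)

lemma coord_sum: "coord i (sum f S) = (\<Sum>x\<in>S. coord i (f x))"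
  unfolding coord_def
  by (subst representation_sum[OF independent_Basis]) (simp_all add: span_Basis)

lemma coord_basis_vec:
  assumes "i < dimension" "j < dimension"
  shows "coord i (basis_vec j) = (if i = j then 1 else 0)"
proof -
  have "basis_vec j \<in> Basis"
    using assms(2) bij_betwE[OF bij_basis_vec] by simp
  moreover have "basis_vec i = basis_vec j \<longleftrightarrow> i = j"
    using assms bij_basis_vec unfolding bij_betw_def by (auto dest: inj_onD)
  ultimately show ?thesis
    unfolding coord_def by (simp add: representation_basis[OF independent_Basis])
qed

lemma sum_coord: "(\<Sum>i<dimension. coord i v *s basis_vec i) = v"
proof -
  have "(\<Sum>i<dimension. coord i v *s basis_vec i) = (\<Sum>b\<in>Basis. representation Basis v b *s b)"
    unfolding coord_def by (rule sum.reindex_bij_betw[OF bij_basis_vec])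
  also have "\<dots> = v"
    by (rule sum_representation_eq) (simp_all add: independent_Basis span_Basis finite_Basis)
  finally show ?thesis .
qed

definition op_mat :: "('m \<Rightarrow> 'm) \<Rightarrow> 'k mat" where
  "op_mat f = mat dimension dimension (\<lambda>(i, j). coord i (f (basis_vec j)))"

lemma op_mat_carrier [simp]: "op_mat f \<in> carrier_mat dimension dimension"
  by (simp add: op_mat_def)

lemma op_mat_comp:
  assumes "endo f"
  shows "op_mat (f \<circ> h) = op_mat f * op_mat h"
proof (rule eq_matI)
  fix i j assume "i < dim_row (op_mat f * op_mat h)" "j < dim_col (op_mat f * op_mat h)"
  then have ij: "i < dimension" "j < dimension"
    by (simp_all add: op_mat_def)
  have "f (h (basis_vec j)) = (\<Sum>l<dimension. coord l (h (basis_vec j)) *s f (basis_vec l))"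
    by (subst (1) sum_coord[symmetric])
      (simp add: pair.linear_sum[OF assms] pair.linear_scale[OF assms])
  then show "op_mat (f \<circ> h) $$ (i, j) = (op_mat f * op_mat h) $$ (i, j)"
    using ij by (simp add: op_mat_def scalar_prod_def coord_sum coord_scale mult.commute
        atLeast0LessThan)
qed (simp_all add: op_mat_def)

definition op_det :: "('m \<Rightarrow> 'm) \<Rightarrow> 'k" where
  "op_det f = det (op_mat f)"

lemma op_det_comp: "endo f \<Longrightarrow> op_det (f \<circ> h) = op_det f * op_det h"
  unfolding op_det_def by (simp add: op_mat_comp det_mult[of _ dimension])

lemma op_det_diagonal:
  assumes "\<And>j. j < dimension \<Longrightarrow> f (basis_vec j) = d j *s basis_vec j"
  shows "op_det f = (\<Prod>j<dimension. d j)"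
proof -
  have "upper_triangular (op_mat f)"
    by (auto simp: op_mat_def assms coord_scale coord_basis_vec)
  then have "op_det f = prod_list (diag_mat (op_mat f))"
    unfolding op_det_def by (rule det_upper_triangular) (rule op_mat_carrier)
  also have "\<dots> = (\<Prod>j<dimension. d j)"
    by (simp add: prod_list_diag_prod op_mat_def assms coord_scale coord_basis_vec atLeast0LessThan)
  finally show ?thesis .
qed

text \<open>
  The determinant does not depend on the basis: if \<open>S\<close> carries the chosen basis to the eigenbasis, then
  \<open>f S = S D\<close> for a diagonal operator \<open>D\<close>, and \<open>det S\<close> can be cancelled.
\<close>

lemma op_det_eigenbasis:
  assumes f: "endo f" and B: "independent B" "span B = UNIV"
    and eig: "\<And>b. b \<in> B \<Longrightarrow> f b = c b *s b"
  shows "op_det f = (\<Prod>b\<in>B. c b)"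
proof -
  have "finite B" "card B = dimension"
    using B finiteI_independent[OF B(1)] dim_eq_card_independent[OF B(1)]
    by (simp_all add: dimension_def) (metis B(2) dim_UNIV dim_span)
  then obtain \<beta> where \<beta>: "bij_betw \<beta> {..<dimension} B"
    by (metis bij_betw_from_nat_into_finite)
  define S where "S = pair.construct Basis (\<lambda>v. \<beta> (the_inv_into {..<dimension} basis_vec v))"
  define S' where "S' = pair.construct B (\<lambda>b. basis_vec (the_inv_into {..<dimension} \<beta> b))"
  define D where "D = pair.construct Basis (\<lambda>v. c (S v) *s v)"
  have lin: "endo S" "endo S'" "endo D"
    unfolding S_def S'_def D_def by (simp_all add: pair.linear_construct B independent_Basis)
  have in_Basis: "basis_vec j \<in> Basis" and in_B: "\<beta> j \<in> B" if "j < dimension" for j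
    using that bij_betwE[OF bij_basis_vec] bij_betwE[OF \<beta>] by auto
  have S: "S (basis_vec j) = \<beta> j" if "j < dimension" for j
    using that bij_basis_vec
    by (simp add: S_def pair.construct_basis independent_Basis in_Basis the_inv_into_f_f bij_betw_def)
  have S': "S' (\<beta> j) = basis_vec j" if "j < dimension" for j
    using that \<beta> by (simp add: S'_def pair.construct_basis B in_B the_inv_into_f_f bij_betw_def)
  have D: "D (basis_vec j) = c (\<beta> j) *s basis_vec j" if "j < dimension" for j
    using that by (simp add: D_def pair.construct_basis independent_Basis in_Basis S)
  have "op_det (S' \<circ> S) = (\<Prod>j<dimension. 1)"
    by (rule op_det_diagonal) (simp add: S S')
  then have inv: "op_det S' * op_det S = 1"
    by (simp add: op_det_comp lin)
  have "f (S v) = S (D v)" for v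
  proof (rule pair.linear_eq_on[of "\<lambda>v. f (S v)" "\<lambda>v. S (D v)" v Basis])
    show "endo (\<lambda>v. f (S v))" "endo (\<lambda>v. S (D v))"
      using lin f by (auto intro!: endoI simp: pair.linear_add pair.linear_scale)
    fix v assume "v \<in> Basis"
    then obtain j where "j < dimension" "v = basis_vec j"
      using bij_basis_vec unfolding bij_betw_def by auto
    then show "f (S v) = S (D v)"
      by (simp add: S D pair.linear_scale[OF lin(1)] eig in_B)
  qed (simp add: span_Basis)
  then have "f \<circ> S = S \<circ> D" by auto
  then have "op_det f * op_det S = op_det S * op_det D"
    using f lin by (metis op_det_comp)
  with inv have "op_det f = op_det D"
    by (metis mult.commute mult_cancel_left mult_zero_right zero_neq_one)
  also have "\<dots> = (\<Prod>j<dimension. c (\<beta> j))"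
    by (rule op_det_diagonal) (rule D)
  also have "\<dots> = (\<Prod>b\<in>B. c b)"
    by (rule prod.reindex_bij_betw[OF \<beta>])
  finally show ?thesis .
qed

text \<open>
  Partitioning a basis into finitely many classes, some possibly empty, decomposes the space: the component
  of \<open>m\<close> in a class is the part of its basis expansion over that class.
\<close>

lemma direct_sum_of_spans:
  assumes B: "independent B" "span B = UNIV" and "finite I" "w ` B \<subseteq> I"
    and V: "\<And>i. i \<in> I \<Longrightarrow> V i = span {b \<in> B. w b = i}"
  shows "is_direct_sum I V"
  unfolding is_direct_sum_def
proof (intro conjI allI)
  show "finite I" by fact
  fix m
  let ?R = "representation B"
  have fin: "finite B"
    using B(1) by (rule finiteI_independent)
  have rep: "(\<Sum>b\<in>B. ?R v b *s b) = v" for v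
    using fin by (intro sum_representation_eq) (simp_all add: B)
  have supp: "?R v b = 0" if "v \<in> V i" "i \<in> I" "w b \<noteq> i" for v b i
  proof -
    have "?R v = representation {b \<in> B. w b = i} v"
      using that V by (intro representation_extend B) auto
    then show ?thesis
      using that(3) representation_ne_zero[of "{b \<in> B. w b = i}" v b] by auto
  qed
  define F where "F = (\<lambda>i\<in>I. \<Sum>b | b \<in> B \<and> w b = i. ?R m b *s b)"
  show "\<exists>!f. f \<in> Pi\<^sub>E I V \<and> m = sum f I"
  proof (intro ex1I[of _ F] conjI)
    show "F \<in> Pi\<^sub>E I V"
      unfolding F_def
    proof (rule restrict_PiE_iff[THEN iffD2], rule ballI)
      fix i assume "i \<in> I"
      have "?R m b *s b \<in> span {b \<in> B. w b = i}" if "b \<in> {b \<in> B. w b = i}" for b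
        by (rule span_scale, rule span_base, rule that)
      then have "(\<Sum>b | b \<in> B \<and> w b = i. ?R m b *s b) \<in> span {b \<in> B. w b = i}"
        by (rule span_sum)
      then show "(\<Sum>b | b \<in> B \<and> w b = i. ?R m b *s b) \<in> V i"
        by (simp only: V[OF \<open>i \<in> I\<close>])
    qed
    have "sum F I = (\<Sum>i\<in>I. \<Sum>b | b \<in> B \<and> w b = i. ?R m b *s b)"
      by (simp add: F_def)
    also have "\<dots> = (\<Sum>b\<in>B. ?R m b *s b)"
      using fin assms(3,4) by (rule sum.group)
    finally show "m = sum F I"
      using rep by simp
    fix f assume f: "f \<in> Pi\<^sub>E I V \<and> m = sum f I"
    show "f = F"
    proof (rule extensionalityI[of _ I])
      show "f \<in> extensional I" "F \<in> extensional I"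
        using f by (auto simp: F_def PiE_def)
      fix i assume i: "i \<in> I"
      have "?R (f i) b = (if w b = i then ?R m b else 0)" if "b \<in> B" for b
      proof (cases "w b = i")
        case True
        have "?R m b = (\<Sum>j\<in>I. ?R (f j) b)"
          using f by (simp add: representation_sum B)
        also have "\<dots> = (\<Sum>j\<in>I. if j = i then ?R (f i) b else 0)"
          using f True by (intro sum.cong) (auto intro: supp)
        finally show ?thesis
          using True i \<open>finite I\<close> by simp
      next
        case False
        then show ?thesis
          using f i by (auto intro: supp)
      qed
      then have "f i = (\<Sum>b\<in>B. (if w b = i then ?R m b else 0) *s b)"
        by (subst rep[symmetric]) (auto intro: sum.cong)
      also have "\<dots> = (\<Sum>b\<in>B. if w b = i then ?R m b *s b else 0)"
        by (intro sum.cong) simp_all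
      also have "\<dots> = F i"
        unfolding F_def using i by (simp add: sum.inter_filter[OF fin])
      finally show "f i = F i" .
    qed
  qed
qed

end

section \<open>Regular functions on irreducible sets\<close>

lemma irreducible_subset_finite_cover:
  assumes "irreducible_subset X S" "finite I" "\<And>i. i \<in> I \<Longrightarrow> closedin X (C i)" "S \<subseteq> (\<Union>i\<in>I. C i)"
  shows "\<exists>i\<in>I. S \<subseteq> C i"
  using assms(2-4)
proof (induction I)
  case empty
  then show ?case
    using assms(1) by (auto simp: irreducible_subset_def)
next
  case (insert j I)
  have "closedin X (C j)" "closedin X (\<Union>i\<in>I. C i)" "S \<subseteq> C j \<union> (\<Union>i\<in>I. C i)"
    using insert by (auto intro: closedin_Union)
  then have "S \<subseteq> C j \<or> S \<subseteq> (\<Union>i\<in>I. C i)"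
    using assms(1) unfolding irreducible_subset_def by blast
  then show ?case
    using insert by auto
qed

text \<open>
  The finitely many fibres of \<open>f\<close> are closed and cover \<open>S\<close>, so one of them contains \<open>S\<close>.
\<close>

lemma regular_function_constant_on_irreducible:
  fixes g :: "('k::field, 'g::ab_group_add) rlie"
  assumes "irreducible_subset (zariski g t) S" and f: "f \<in> hom_polys g t"
    and "finite V" "f ` S \<subseteq> V"
  shows "\<exists>v\<in>V. \<forall>\<phi>\<in>S. f \<phi> = v"
proof -
  have irr: "S \<subseteq> embeddings g t"
    using assms(1) by (simp add: irreducible_subset_def topspace_zariski)
  let ?C = "\<lambda>v. {\<phi> \<in> embeddings g t. f \<phi> = v}"
  have "closedin (zariski g t) (?C v)" for v
  proof -
    have "(\<lambda>\<phi>. f \<phi> + (- v)) \<in> hom_polys g t"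
      using f by (intro hom_polys.add hom_polys.const)
    moreover have "?C v = {\<phi> \<in> embeddings g t. \<forall>f'\<in>{\<lambda>\<phi>. f \<phi> + (- v)}. f' \<phi> = 0}"
      by auto
    ultimately show ?thesis
      unfolding closedin_zariski by blast
  qed
  moreover have "S \<subseteq> (\<Union>v\<in>V. ?C v)"
    using assms(4) irr by blast
  ultimately have "\<exists>v\<in>V. S \<subseteq> ?C v"
    using assms(1,3) by (intro irreducible_subset_finite_cover)
  then show ?thesis
    by auto
qed

lemma hom_polys_sum:
  assumes "\<And>i. i \<in> I \<Longrightarrow> (\<lambda>\<phi>. f i \<phi>) \<in> hom_polys g t"
  shows "(\<lambda>\<phi>. \<Sum>i\<in>I. f i \<phi>) \<in> hom_polys g t"
  using assms
  by (induction I rule: infinite_finite_induct) (auto intro: hom_polys.const hom_polys.add)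

lemma hom_polys_prod:
  assumes "\<And>i. i \<in> I \<Longrightarrow> (\<lambda>\<phi>. f i \<phi>) \<in> hom_polys g t"
  shows "(\<lambda>\<phi>. \<Prod>i\<in>I. f i \<phi>) \<in> hom_polys g t"
  using assms
  by (induction I rule: infinite_finite_induct) (auto intro: hom_polys.const hom_polys.mult)

section \<open>Weights along a homomorphism of the torus\<close>

text \<open>
  The list \<open>ys\<close> spans the torus.  It is a list because the operators attached to its members are composed in
  some order.
\<close>

locale torus_module = alg_closed_vector_space scale Basis
  for scale :: "'k::alg_closed_field \<Rightarrow> 'm::ab_group_add \<Rightarrow> 'm" (infixr "*s" 75)
    and Basis +
  fixes g :: "('k, 'g::ab_group_add) rlie" and t :: "'g set" and act :: "'g \<Rightarrow> 'm \<Rightarrow> 'm"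
    and ys :: "'g list"
  assumes restricted_lie_algebra: "restricted_lie_algebra g"
    and torus: "torus g t"
    and restricted_module: "restricted_module g scale act"
    and ys: "set ys \<subseteq> t" "t \<subseteq> module.span (scl g) (set ys)"
begin

sublocale G: vector_space "scl g"
  using restricted_lie_algebra by (simp add: restricted_lie_algebra_def)

lemma subspace_t: "G.subspace t"
  using torus by (simp add: torus_def p_subalgebra_def)

lemma brk_t: "x \<in> t \<Longrightarrow> y \<in> t \<Longrightarrow> brk g x y = 0"
  using torus by (simp add: torus_def)

lemma pmap_t: "x \<in> t \<Longrightarrow> pmap g x \<in> t"
  using torus by (simp add: torus_def p_subalgebra_def)

lemma act_endo: "endo (act x)"
  using restricted_module by (simp add: restricted_module_def)

lemma act_linear: "Vector_Spaces.linear (scl g) (*s) (\<lambda>x. act x m)"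
  using restricted_module by (simp add: restricted_module_def)

lemma act_add: "act (x + y) m = act x m + act y m"
  and act_scl: "act (scl g c x) m = c *s act x m"
  using act_linear[of m] by (simp_all add: Vector_Spaces.linear_iff)

lemma act_0: "act 0 m = 0"
  using act_scl[of 0 0] by simp

lemma act_brk: "act (brk g x y) m = act x (act y m) - act y (act x m)"
  using restricted_module by (simp add: restricted_module_def)

lemma act_pmap: "act (pmap g x) m = (act x ^^ CHAR('k)) m"
  using restricted_module by (simp add: restricted_module_def)

abbreviation homs :: "('g \<Rightarrow> 'g) set" where
  "homs \<equiv> rlie_homs g t g"

lemma hom_add: "\<phi> \<in> homs \<Longrightarrow> x \<in> t \<Longrightarrow> y \<in> t \<Longrightarrow> \<phi> (x + y) = \<phi> x + \<phi> y"
  and hom_scl: "\<phi> \<in> homs \<Longrightarrow> x \<in> t \<Longrightarrow> \<phi> (scl g c x) = scl g c (\<phi> x)"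
  and hom_brk: "\<phi> \<in> homs \<Longrightarrow> x \<in> t \<Longrightarrow> y \<in> t \<Longrightarrow> \<phi> (brk g x y) = brk g (\<phi> x) (\<phi> y)"
  and hom_pmap: "\<phi> \<in> homs \<Longrightarrow> x \<in> t \<Longrightarrow> \<phi> (pmap g x) = pmap g (\<phi> x)"
  by (auto simp: rlie_homs_def linear_maps_on_def)

lemma hom_0: "\<phi> \<in> homs \<Longrightarrow> \<phi> 0 = 0"
  using hom_scl[of \<phi> 0 0] G.subspace_0[OF subspace_t] by simp

lemma act_hom_commute:
  assumes "\<phi> \<in> homs" "x \<in> t" "y \<in> t"
  shows "act (\<phi> x) (act (\<phi> y) m) = act (\<phi> y) (act (\<phi> x) m)"
proof -
  have "act (brk g (\<phi> x) (\<phi> y)) m = 0"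
    using hom_brk[OF assms] assms by (simp add: brk_t hom_0 act_0)
  then show ?thesis
    by (simp add: act_brk)
qed

text \<open>
  The elements \<open>y\<close> of the torus that act, along every \<open>\<phi>\<close>, as a polynomial in \<open>x\<close> with derivative zero
  form a \<open>p\<close>-subalgebra: brackets vanish, sums and multiples are clear, and the \<open>p\<close>-map raises the
  polynomial to the power \<open>p\<close>.  It contains the image of \<open>x\<close> under the \<open>p\<close>-map, through the polynomial
  \<open>X\<^sup>p\<close>, hence also \<open>x\<close> itself, because \<open>x\<close> is semisimple.  If \<open>q\<close> is the polynomial of \<open>x\<close>,
  then \<open>X - q\<close> annihilates the action of \<open>x\<close> and has derivative 1.  The quantifier over \<open>\<phi>\<close> is inside:
  one polynomial serves all homomorphisms.
\<close>

lemma separable_annihilator: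
  assumes "x \<in> t"
  shows "\<exists>q. separable q \<and> (\<forall>\<phi>\<in>homs. \<forall>m. operator_poly q (act (\<phi> x)) m = 0)"
proof -
  let ?P = "\<lambda>q y. \<forall>\<phi>\<in>homs. \<forall>m. act (\<phi> y) m = operator_poly q (act (\<phi> x)) m"
  let ?T = "{y \<in> t. \<exists>q. pderiv q = 0 \<and> ?P q y}"
  note op = operator_poly_pCons[OF act_endo] operator_poly_add[OF act_endo]
    operator_poly_smult[OF act_endo] operator_poly_power[OF act_endo]
  have "p_subalgebra g ?T"
    unfolding p_subalgebra_def
  proof (intro conjI ballI)
    have zero: "0 \<in> ?T"
      using G.subspace_0[OF subspace_t]
      by (auto intro!: exI[of _ 0] simp: hom_0 act_0)
    show "G.subspace ?T"
    proof (rule G.subspaceI)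
      show "0 \<in> ?T" by (rule zero)
      fix y z assume "y \<in> ?T" "z \<in> ?T"
      then obtain q r where yz: "y \<in> t" "z \<in> t" "pderiv q = 0" "?P q y" "pderiv r = 0" "?P r z"
        by blast
      then have "?P (q + r) (y + z)" "pderiv (q + r) = 0"
        by (simp_all add: op hom_add act_add pderiv_add)
      with yz show "y + z \<in> ?T"
        using G.subspace_add[OF subspace_t] by blast
    next
      fix c y assume "y \<in> ?T"
      then obtain q where y: "y \<in> t" "pderiv q = 0" "?P q y"
        by blast
      then have "?P (Polynomial.smult c q) (scl g c y)" "pderiv (Polynomial.smult c q) = 0"
        by (simp_all add: op hom_scl act_scl pderiv_smult)
      with y show "scl g c y \<in> ?T"
        using G.subspace_scale[OF subspace_t] by blast
    qed
    show "brk g y z \<in> ?T" if "y \<in> ?T" "z \<in> ?T" for y z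
      using that zero by (auto simp: brk_t)
    show "pmap g y \<in> ?T" if y: "y \<in> ?T" for y
    proof -
      obtain q where q: "y \<in> t" "pderiv q = 0" "?P q y"
        using y by blast
      have "pderiv (q ^ CHAR('k)) = 0"
        using q(2) by (simp add: pderiv_power)
      moreover have "?P (q ^ CHAR('k)) (pmap g y)"
      proof (intro ballI allI)
        fix \<phi> m assume \<phi>: "\<phi> \<in> homs"
        then have "act (\<phi> y) = operator_poly q (act (\<phi> x))"
          using q(3) by (intro ext) blast
        then show "act (\<phi> (pmap g y)) m = operator_poly (q ^ CHAR('k)) (act (\<phi> x)) m"
          using \<phi> q(1) by (simp only: hom_pmap act_pmap op)
      qed
      ultimately show ?thesis
        using q(1) pmap_t by blast
    qed
  qed
  moreover have "pmap g x \<in> ?T"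
  proof -
    let ?q = "[:0, 1:] ^ CHAR('k) :: 'k poly"
    have X: "operator_poly [:0, 1:] (act (\<phi> x)) = act (\<phi> x)" for \<phi>
      using operator_poly_X[OF act_endo] by blast
    have "pderiv ?q = 0"
      unfolding pderiv_power by simp
    moreover have "?P ?q (pmap g x)"
      using assms by (simp add: hom_pmap act_pmap op(4) X)
    ultimately show ?thesis
      using assms pmap_t by blast
  qed
  ultimately have "p_subalgebra g hull {pmap g x} \<subseteq> ?T"
    by (intro hull_minimal) simp_all
  moreover have "x \<in> p_subalgebra g hull {pmap g x}"
    using torus assms by (simp add: torus_def semisimple_def)
  ultimately obtain q where q: "pderiv q = 0" "?P q x"
    by blast
  have "pderiv ([:0, 1:] - q) = 1"
    using q(1) by (simp add: pderiv_diff pderiv_pCons)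
  then have "separable ([:0, 1:] - q)"
    by (simp add: separable_def)
  moreover have "operator_poly ([:0, 1:] - q) (act (\<phi> x)) m = 0" if "\<phi> \<in> homs" for \<phi> m
    using q(2) that by (simp add: operator_poly_diff[OF act_endo] operator_poly_X[OF act_endo])
  ultimately show ?thesis
    by blast
qed

abbreviation linear_forms :: "('g \<Rightarrow> 'k) set" where
  "linear_forms \<equiv> linear_maps_on g t field_rlie"

lemma form_add: "\<mu> \<in> linear_forms \<Longrightarrow> x \<in> t \<Longrightarrow> y \<in> t \<Longrightarrow> \<mu> (x + y) = \<mu> x + \<mu> y"
  and form_scl: "\<mu> \<in> linear_forms \<Longrightarrow> x \<in> t \<Longrightarrow> \<mu> (scl g c x) = c * \<mu> x"
  by (auto simp: linear_maps_on_def field_rlie_def)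

lemma form_0: "\<mu> \<in> linear_forms \<Longrightarrow> \<mu> 0 = 0"
  using form_scl[of \<mu> 0 0] G.subspace_0[OF subspace_t] by simp

lemma t_subset:
  assumes "G.subspace S" "set ys \<subseteq> S"
  shows "t \<subseteq> S"
  using ys(2) G.span_minimal[OF assms(2,1)] by blast

lemma form_eqI:
  assumes "\<mu> \<in> linear_forms" "\<nu> \<in> linear_forms" "\<And>x. x \<in> set ys \<Longrightarrow> \<mu> x = \<nu> x"
  shows "\<mu> = \<nu>"
proof -
  have "t \<subseteq> {x \<in> t. \<mu> x = \<nu> x}"
  proof (rule t_subset)
    show "G.subspace {x \<in> t. \<mu> x = \<nu> x}"
      using subspace_t by (auto simp: G.subspace_def form_0 form_add form_scl assms)
  qed (use ys(1) assms(3) in auto)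
  moreover have "\<mu> \<in> extensional t" "\<nu> \<in> extensional t"
    using assms by (simp_all add: linear_maps_on_def)
  ultimately show ?thesis
    by (blast intro: extensionalityI)
qed

text \<open>
  The weight spaces of the module pulled back along \<open>\<phi>\<close>.
\<close>

abbreviation weight_space_at :: "('g \<Rightarrow> 'g) \<Rightarrow> ('g \<Rightarrow> 'k) \<Rightarrow> 'm set" where
  "weight_space_at \<phi> \<equiv> weight_space (*s) (\<lambda>x. act (\<phi> x)) t"

lemma subspace_weight_space: "subspace (weight_space (*s) (\<lambda>x. act (\<phi> x)) T \<mu>)"
  unfolding weight_space_def
  by (rule subspaceI)
    (auto simp: pair.linear_0[OF act_endo] pair.linear_add[OF act_endo]
      pair.linear_scale[OF act_endo] scale_right_distrib mult.commute)

text \<open>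
  The elements of \<open>t\<close> having \<open>b\<close> as an eigenvector form a subspace containing the spanning list; the
  eigenvalue is unique because \<open>b\<close> is nonzero, and therefore depends linearly on the element.
\<close>

lemma common_eigenvector_has_weight:
  assumes \<phi>: "\<phi> \<in> homs" and b: "b \<noteq> 0" "\<forall>x\<in>set ys. \<exists>a. act (\<phi> x) b = a *s b"
  shows "\<exists>\<nu>\<in>linear_forms. b \<in> weight_space_at \<phi> \<nu>"
proof -
  let ?S = "{x \<in> t. \<exists>a. act (\<phi> x) b = a *s b}"
  have "t \<subseteq> ?S"
  proof (rule t_subset)
    show "G.subspace ?S"
    proof (rule G.subspaceI)
      show "0 \<in> ?S"
        using G.subspace_0[OF subspace_t] \<phi> by (auto simp: hom_0 act_0 intro: exI[of _ 0])
      fix x y assume "x \<in> ?S" "y \<in> ?S"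
      then obtain a a' where xy: "x \<in> t" "y \<in> t" "act (\<phi> x) b = a *s b" "act (\<phi> y) b = a' *s b"
        by blast
      then have "act (\<phi> (x + y)) b = (a + a') *s b"
        using \<phi> by (simp add: hom_add act_add scale_left_distrib)
      with xy show "x + y \<in> ?S"
        using G.subspace_add[OF subspace_t] by blast
    next
      fix c x assume "x \<in> ?S"
      then obtain a where x: "x \<in> t" "act (\<phi> x) b = a *s b"
        by blast
      then have "act (\<phi> (scl g c x)) b = (c * a) *s b"
        using \<phi> by (simp add: hom_scl act_scl)
      with x show "scl g c x \<in> ?S"
        using G.subspace_scale[OF subspace_t] by blast
    qed
  qed (use ys(1) b in auto)
  define \<nu> where "\<nu> = (\<lambda>x\<in>t. SOME a. act (\<phi> x) b = a *s b)"
  have \<nu>: "act (\<phi> x) b = \<nu> x *s b" if "x \<in> t" for x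
  proof -
    have "\<exists>a. act (\<phi> x) b = a *s b"
      using that \<open>t \<subseteq> ?S\<close> by blast
    then show ?thesis
      using that by (simp add: \<nu>_def) (rule someI_ex)
  qed
  have cancel: "a = a'" if "a *s b = a' *s b" for a a'
    using that b(1) by simp
  have "\<nu> \<in> linear_forms"
    unfolding linear_maps_on_def
  proof (intro CollectI conjI ballI allI)
    show "\<nu> \<in> extensional t"
      by (simp add: \<nu>_def)
    fix x assume x: "x \<in> t"
    show "\<nu> (x + y) = \<nu> x + \<nu> y" if y: "y \<in> t" for y
      using x y \<phi> G.subspace_add[OF subspace_t x y]
      by (intro cancel) (simp add: \<nu>[symmetric] hom_add act_add scale_left_distrib)
    show "\<nu> (scl g c x) = scl field_rlie c (\<nu> x)" for c
      using x \<phi> G.subspace_scale[OF subspace_t x]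
      by (intro cancel)
        (simp add: \<nu>[symmetric] hom_scl act_scl field_rlie_def flip: scale_scale)
  qed
  moreover have "b \<in> weight_space_at \<phi> \<nu>"
    unfolding weight_space_def using \<nu> by blast
  ultimately show ?thesis
    by blast
qed

lemma weight_basis_exists:
  assumes \<phi>: "\<phi> \<in> homs"
  shows "\<exists>B \<nu>. independent B \<and> span B = UNIV \<and>
    (\<forall>b\<in>B. \<nu> b \<in> linear_forms \<and> b \<in> weight_space_at \<phi> (\<nu> b))"
proof -
  let ?E = "{m. \<forall>x\<in>set ys. \<exists>a. act (\<phi> x) m = a *s m}"
  have "span ?E = UNIV"
  proof (rule simultaneous_eigenvectors_span)
    show "act (\<phi> x) (act (\<phi> y) m) = act (\<phi> y) (act (\<phi> x) m)"
      if "x \<in> set ys" "y \<in> set ys" for x y m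
      using that ys(1) \<phi> by (intro act_hom_commute) auto
    show "\<exists>q. separable q \<and> (\<forall>m. operator_poly q (act (\<phi> x)) m = 0)" if "x \<in> set ys" for x
      using that ys(1) \<phi> separable_annihilator[of x] by blast
  qed (simp_all add: act_endo)
  moreover obtain B where B: "B \<subseteq> ?E" "independent B" "?E \<subseteq> span B"
    using maximal_independent_subset by blast
  ultimately have "span B = UNIV"
    using span_minimal[OF B(3) subspace_span] by blast
  moreover have "\<forall>b\<in>B. \<exists>\<nu>. \<nu> \<in> linear_forms \<and> b \<in> weight_space_at \<phi> \<nu>"
  proof
    fix b assume b: "b \<in> B"
    then have "b \<noteq> 0"
      using B(2) dependent_zero by blast
    then show "\<exists>\<nu>. \<nu> \<in> linear_forms \<and> b \<in> weight_space_at \<phi> \<nu>"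
      using common_eigenvector_has_weight[OF \<phi>] b B(1) by blast
  qed
  ultimately show ?thesis
    using B(2) by (metis bchoice)
qed

text \<open>
  Comparing the coefficients of \<open>x \<cdot> v = \<mu> x v\<close> in a basis of weight vectors shows that only vectors of
  weight \<open>\<mu>\<close> occur in the expansion of \<open>v\<close>.
\<close>

lemma weight_space_eq_span:
  assumes B: "independent B" "span B = UNIV"
    and \<nu>: "\<And>b. b \<in> B \<Longrightarrow> \<nu> b \<in> linear_forms \<and> b \<in> weight_space_at \<phi> (\<nu> b)"
    and \<mu>: "\<mu> \<in> linear_forms"
  shows "weight_space_at \<phi> \<mu> = span {b \<in> B. \<nu> b = \<mu>}"
proof
  show "span {b \<in> B. \<nu> b = \<mu>} \<subseteq> weight_space_at \<phi> \<mu>"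
    using \<nu> by (intro span_minimal subspace_weight_space) auto
  show "weight_space_at \<phi> \<mu> \<subseteq> span {b \<in> B. \<nu> b = \<mu>}"
  proof
    fix v assume v: "v \<in> weight_space_at \<phi> \<mu>"
    let ?R = "representation B"
    have rep: "(\<Sum>b\<in>B. ?R v b *s b) = v" for v
      using finiteI_independent[OF B(1)] by (intro sum_representation_eq) (simp_all add: B)
    have "\<nu> b = \<mu>" if b: "b \<in> B" "?R v b \<noteq> 0" for b
    proof (rule extensionalityI[of _ t])
      fix x assume x: "x \<in> t"
      have "act (\<phi> x) v = (\<Sum>b\<in>B. (?R v b * \<nu> b x) *s b)"
      proof -
        have "act (\<phi> x) v = (\<Sum>b\<in>B. ?R v b *s act (\<phi> x) b)"
          by (subst (1) rep[symmetric])
            (simp add: pair.linear_sum[OF act_endo] pair.linear_scale[OF act_endo])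
        also have "\<dots> = (\<Sum>b\<in>B. (?R v b * \<nu> b x) *s b)"
          using \<nu> x by (intro sum.cong) (auto simp: weight_space_def)
        finally show ?thesis .
      qed
      then have "?R (act (\<phi> x) v) b = (\<Sum>b'\<in>B. (?R v b' * \<nu> b' x) * ?R b' b)"
        by (simp add: representation_sum representation_scale B)
      also have "\<dots> = (\<Sum>b'\<in>B. if b' = b then ?R v b * \<nu> b x else 0)"
        by (intro sum.cong) (auto simp: representation_basis[OF B(1)])
      also have "\<dots> = ?R v b * \<nu> b x"
        using b(1) finiteI_independent[OF B(1)] by simp
      finally have "?R (act (\<phi> x) v) b = ?R v b * \<nu> b x" .
      moreover have "?R (act (\<phi> x) v) b = \<mu> x * ?R v b"
        using v x by (simp add: weight_space_def representation_scale B)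
      ultimately show "\<nu> b x = \<mu> x"
        using b(2) by simp
    qed (use \<nu>[OF b(1)] \<mu> in \<open>simp_all add: linear_maps_on_def\<close>)
    then have "?R v b *s b \<in> span {b \<in> B. \<nu> b = \<mu>}" if "b \<in> B" for b
      using that by (cases "?R v b = 0") (auto intro: span_zero span_scale span_base)
    then have "(\<Sum>b\<in>B. ?R v b *s b) \<in> span {b \<in> B. \<nu> b = \<mu>}"
      by (rule span_sum)
    then show "v \<in> span {b \<in> B. \<nu> b = \<mu>}"
      by (simp only: rep)
  qed
qed

section \<open>The multiplicity of a weight as a regular function\<close>

lemma dim_weight_space:
  assumes B: "independent B" "span B = UNIV"
    and \<nu>: "\<And>b. b \<in> B \<Longrightarrow> \<nu> b \<in> linear_forms \<and> b \<in> weight_space_at \<phi> (\<nu> b)"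
    and \<mu>: "\<mu> \<in> linear_forms"
  shows "dim (weight_space_at \<phi> \<mu>) = card {b \<in> B. \<nu> b = \<mu>}"
proof -
  have "independent {b \<in> B. \<nu> b = \<mu>}"
    by (rule independent_mono[OF B(1)]) blast
  then have "dim (span {b \<in> B. \<nu> b = \<mu>}) = card {b \<in> B. \<nu> b = \<mu>}"
    by (rule dim_span_eq_card_independent)
  with arg_cong[OF weight_space_eq_span[OF assms]] show ?thesis
    by (rule trans)
qed

text \<open>
  One polynomial per element of the torus, chosen once for all homomorphisms, so that the operators built
  from it vary algebraically with the homomorphism.
\<close>

definition annihilator :: "'g \<Rightarrow> 'k poly" where
  "annihilator x = (SOME q. separable q \<and> (\<forall>\<phi>\<in>homs. \<forall>m. operator_poly q (act (\<phi> x)) m = 0))"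

text \<open>
  The interpolation polynomial with value 1 at \<open>\<mu> x\<close> and 0 at the other possible eigenvalues of \<open>x\<close>.
  If \<open>\<mu> x\<close> is itself not a possible eigenvalue, it vanishes at all of them, which fits a zero projector.
\<close>

definition lagrange :: "('g \<Rightarrow> 'k) \<Rightarrow> 'g \<Rightarrow> 'k poly" where
  "lagrange \<mu> x = (\<Prod>a \<in> {a. poly (annihilator x) a = 0} - {\<mu> x}.
     Polynomial.smult (inverse (\<mu> x - a)) [:- a, 1:])"

lemma annihilator:
  assumes "x \<in> t"
  shows "separable (annihilator x)" "\<phi> \<in> homs \<Longrightarrow> operator_poly (annihilator x) (act (\<phi> x)) m = 0"
  using someI_ex[OF separable_annihilator[OF assms]] unfolding annihilator_def by blast+

lemma poly_lagrange:
  assumes x: "x \<in> t" and a: "poly (annihilator x) a = 0"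
  shows "poly (lagrange \<mu> x) a = (if a = \<mu> x then 1 else 0)"
proof -
  have "annihilator x \<noteq> 0"
    using annihilator(1)[OF x] by (auto simp: separable_def)
  then have fin: "finite {a. poly (annihilator x) a = 0}"
    by (rule poly_roots_finite)
  show ?thesis
  proof (cases "a = \<mu> x")
    case True
    have "poly (Polynomial.smult (inverse (\<mu> x - b)) [:- b, 1:]) (\<mu> x) = 1" if "b \<noteq> \<mu> x" for b
    proof -
      have "poly [:- b, 1:] (\<mu> x) = \<mu> x - b"
        by simp
      then show ?thesis
        using that by (simp only: poly_smult) simp
    qed
    then show ?thesis
      using True unfolding lagrange_def poly_prod by (simp only: simp_thms if_True) (rule prod.neutral, blast)
  next
    case False
    then show ?thesis
      using fin a by (auto simp: lagrange_def poly_prod intro!: bexI[of _ a])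
  qed
qed

text \<open>
  Along a homomorphism, and for \<open>zs = ys\<close>, the projector onto the weight space of \<open>\<mu>\<close> that kills the other
  weight spaces.  The list is an argument for the sake of induction.
\<close>

definition weight_projector :: "('g \<Rightarrow> 'k) \<Rightarrow> 'g list \<Rightarrow> ('g \<Rightarrow> 'g) \<Rightarrow> 'm \<Rightarrow> 'm" where
  "weight_projector \<mu> zs \<phi> = foldr (\<lambda>x. operator_poly (lagrange \<mu> x) (act (\<phi> x))) zs"

text \<open>
  The operator \<open>1 + (c - 1) P\<close> for the projector \<open>P\<close>: it multiplies the weight space of \<open>\<mu>\<close> by \<open>c\<close> and
  fixes the others.
\<close>

definition weight_stretch :: "'k \<Rightarrow> ('g \<Rightarrow> 'k) \<Rightarrow> ('g \<Rightarrow> 'g) \<Rightarrow> 'm \<Rightarrow> 'm" where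
  "weight_stretch c \<mu> \<phi> m = m + (c - 1) *s weight_projector \<mu> ys \<phi> m"

lemma weight_projector_simps [simp]:
  "weight_projector \<mu> [] \<phi> m = m"
  "weight_projector \<mu> (x # zs) \<phi> m = operator_poly (lagrange \<mu> x) (act (\<phi> x)) (weight_projector \<mu> zs \<phi> m)"
  by (simp_all add: weight_projector_def)

lemma endo_weight_projector: "endo (weight_projector \<mu> zs \<phi>)"
proof (induction zs)
  case Nil
  show ?case by (rule endoI) simp_all
next
  case (Cons x zs)
  note lin = linear_operator_poly[OF act_endo]
  show ?case
    by (rule endoI)
      (simp_all add: pair.linear_add[OF Cons] pair.linear_scale[OF Cons]
        pair.linear_add[OF lin] pair.linear_scale[OF lin])
qed

lemma endo_weight_stretch: "endo (weight_stretch c \<mu> \<phi>)"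
  by (rule endoI)
    (simp_all add: weight_stretch_def pair.linear_add[OF endo_weight_projector]
      pair.linear_scale[OF endo_weight_projector] scale_right_distrib mult.commute add_ac)

lemma weight_projector_weight_vector:
  assumes \<phi>: "\<phi> \<in> homs" and b: "b \<noteq> 0" "b \<in> weight_space_at \<phi> \<nu>" and zs: "set zs \<subseteq> t"
  shows "weight_projector \<mu> zs \<phi> b = (if \<forall>x\<in>set zs. \<nu> x = \<mu> x then b else 0)"
  using zs
proof (induction zs)
  case (Cons x zs)
  then have x: "x \<in> t"
    by simp
  then have eig: "act (\<phi> x) b = \<nu> x *s b"
    using b by (simp add: weight_space_def)
  note op_b = operator_poly_eigenvector[OF act_endo eig]
  have "poly (annihilator x) (\<nu> x) *s b = 0"
    using annihilator(2)[OF x \<phi>, of b] by (simp only: op_b)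
  then have "poly (annihilator x) (\<nu> x) = 0"
    using b(1) by simp
  then have "operator_poly (lagrange \<mu> x) (act (\<phi> x)) b = (if \<nu> x = \<mu> x then b else 0)"
    using x by (simp add: op_b poly_lagrange)
  then show ?case
    using Cons pair.linear_0[OF linear_operator_poly[OF act_endo]] by auto
qed simp

lemma weight_stretch_weight_vector:
  assumes "\<phi> \<in> homs" "b \<noteq> 0" "b \<in> weight_space_at \<phi> \<nu>" "\<nu> \<in> linear_forms" "\<mu> \<in> linear_forms"
  shows "weight_stretch c \<mu> \<phi> b = (if \<nu> = \<mu> then c else 1) *s b"
proof -
  have "weight_projector \<mu> ys \<phi> b = (if \<nu> = \<mu> then b else 0)"
    using weight_projector_weight_vector[OF assms(1-3) ys(1)] form_eqI[OF assms(4,5)] by auto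
  then show ?thesis
    by (simp add: weight_stretch_def scale_left_diff_distrib)
qed

text \<open>
  In a basis of weight vectors the operator is diagonal, with entry \<open>c\<close> once for every basis vector of weight
  \<open>\<mu>\<close> and entry 1 elsewhere.
\<close>

lemma op_det_weight_stretch:
  assumes \<phi>: "\<phi> \<in> homs" and \<mu>: "\<mu> \<in> linear_forms"
  shows "op_det (weight_stretch c \<mu> \<phi>) = c ^ dim (weight_space_at \<phi> \<mu>)"
proof -
  obtain B \<nu> where B: "independent B" "span B = UNIV"
    and \<nu>: "\<And>b. b \<in> B \<Longrightarrow> \<nu> b \<in> linear_forms \<and> b \<in> weight_space_at \<phi> (\<nu> b)"
    using weight_basis_exists[OF \<phi>] by blast
  have "op_det (weight_stretch c \<mu> \<phi>) = (\<Prod>b\<in>B. if \<nu> b = \<mu> then c else 1)"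
  proof (rule op_det_eigenbasis[OF endo_weight_stretch B])
    fix b assume b: "b \<in> B"
    then have "b \<noteq> 0"
      using B(1) dependent_zero by blast
    then show "weight_stretch c \<mu> \<phi> b = (if \<nu> b = \<mu> then c else 1) *s b"
      using \<nu>[OF b] \<phi> \<mu> by (intro weight_stretch_weight_vector) auto
  qed
  also have "\<dots> = (\<Prod>b\<in>{b \<in> B. \<nu> b = \<mu>}. c)"
    by (rule prod.inter_filter[symmetric]) (rule finiteI_independent[OF B(1)])
  also have "\<dots> = c ^ dim (weight_space_at \<phi> \<mu>)"
    using dim_weight_space[OF B \<nu> \<mu>] by simp
  finally show ?thesis .
qed

text \<open>
  Polynomial maps into the module, tested on coordinates.  The argument ranges over arbitrary maps, not only
  embeddings, because the members of \<open>hom_polys\<close> are functions of arbitrary maps.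
\<close>

definition regular_family :: "(('g \<Rightarrow> 'g) \<Rightarrow> 'm) \<Rightarrow> bool" where
  "regular_family v \<longleftrightarrow> (\<forall>i. (\<lambda>\<phi>. coord i (v \<phi>)) \<in> hom_polys g t)"

lemma regular_family_const: "regular_family (\<lambda>\<phi>. m)"
  by (simp add: regular_family_def hom_polys.const)

lemma regular_family_add:
  "regular_family v \<Longrightarrow> regular_family w \<Longrightarrow> regular_family (\<lambda>\<phi>. v \<phi> + w \<phi>)"
  by (simp add: regular_family_def coord_add hom_polys.add)

lemma regular_family_scale: "regular_family v \<Longrightarrow> regular_family (\<lambda>\<phi>. c *s v \<phi>)"
  by (simp add: regular_family_def coord_scale hom_polys.mult hom_polys.const)

text \<open>
  The coordinates of \<open>\<phi> x \<cdot> v \<phi>\<close> are bilinear in those of \<open>v \<phi>\<close> and in the matrix entries of the action of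
  \<open>\<phi> x\<close>, and the latter are linear forms in \<open>\<phi> x\<close>.
\<close>

lemma regular_family_act:
  assumes x: "x \<in> t" and v: "regular_family v"
  shows "regular_family (\<lambda>\<phi>. act (\<phi> x) (v \<phi>))"
  unfolding regular_family_def
proof
  fix i
  have "coord i (act (\<phi> x) (v \<phi>)) =
      (\<Sum>l<dimension. coord l (v \<phi>) * coord i (act (\<phi> x) (basis_vec l)))" for \<phi>
    by (subst (1) sum_coord[of "v \<phi>", symmetric])
      (simp add: pair.linear_sum[OF act_endo] pair.linear_scale[OF act_endo] coord_sum coord_scale)
  moreover have "(\<lambda>\<phi>. coord i (act (\<phi> x) (basis_vec l))) \<in> hom_polys g t" for l
  proof (rule hom_polys.coord[OF x])
    show "Vector_Spaces.linear (scl g) (*) (\<lambda>y. coord i (act y (basis_vec l)))"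
      using Vector_Spaces.linear_compose[OF act_linear linear_coord] by (simp add: o_def)
  qed
  ultimately show "(\<lambda>\<phi>. coord i (act (\<phi> x) (v \<phi>))) \<in> hom_polys g t"
    using v by (simp add: regular_family_def hom_polys_sum hom_polys.mult)
qed

lemma regular_family_operator_poly:
  assumes "x \<in> t" "regular_family v"
  shows "regular_family (\<lambda>\<phi>. operator_poly q (act (\<phi> x)) (v \<phi>))"
  by (induction q)
    (simp_all add: operator_poly_pCons[OF act_endo] regular_family_const regular_family_add
      regular_family_scale regular_family_act assms)

lemma regular_family_weight_projector:
  assumes "set zs \<subseteq> t" "regular_family v"
  shows "regular_family (\<lambda>\<phi>. weight_projector \<mu> zs \<phi> (v \<phi>))"
  using assms(1) by (induction zs) (simp_all add: assms(2) regular_family_operator_poly)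

lemma op_det_weight_stretch_regular:
  "(\<lambda>\<phi>. op_det (weight_stretch c \<mu> \<phi>)) \<in> hom_polys g t"
proof -
  have "regular_family (\<lambda>\<phi>. weight_stretch c \<mu> \<phi> m)" for m
    unfolding weight_stretch_def
    by (intro regular_family_add regular_family_scale regular_family_const
        regular_family_weight_projector[OF ys(1)])
  then have entries: "(\<lambda>\<phi>. coord i (weight_stretch c \<mu> \<phi> m)) \<in> hom_polys g t" for i m
    by (simp add: regular_family_def)
  have "op_det (weight_stretch c \<mu> \<phi>) =
      (\<Sum>p | p permutes {0..<dimension}. signof p *
        (\<Prod>i = 0..<dimension. coord i (weight_stretch c \<mu> \<phi> (basis_vec (p i)))))" for \<phi>
    unfolding op_det_def det_def'[OF op_mat_carrier]
    by (intro sum.cong arg_cong2[where f = "(*)"] prod.cong refl)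
      (auto simp: op_mat_def permutes_in_image)
  then show ?thesis
    by (simp add: hom_polys_sum hom_polys_prod hom_polys.mult hom_polys.const entries)
qed

text \<open>
  The determinant of \<open>weight_stretch\<close> is regular and takes values among finitely many powers of \<open>c\<close>, so it is
  constant on \<open>S\<close>; distinctness of these powers recovers the exponent.
\<close>

lemma dim_weight_space_constant:
  assumes S: "irreducible_subset (zariski g t) S" "\<phi> \<in> S" "\<psi> \<in> S" and \<mu>: "\<mu> \<in> linear_forms"
  shows "dim (weight_space_at \<phi> \<mu>) = dim (weight_space_at \<psi> \<mu>)"
proof -
  obtain c :: 'k where c: "inj_on (\<lambda>i. c ^ i) {..dimension}"
    using exists_injective_powers by blast
  have homs: "\<theta> \<in> homs" if "\<theta> \<in> S" for \<theta>
    using S(1) that by (auto simp: irreducible_subset_def topspace_zariski embeddings_def)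
  let ?f = "\<lambda>\<phi>. op_det (weight_stretch c \<mu> \<phi>)"
  have f: "?f \<theta> = c ^ dim (weight_space_at \<theta> \<mu>)" if "\<theta> \<in> S" for \<theta>
    using op_det_weight_stretch[OF homs[OF that] \<mu>] .
  have "\<exists>v\<in>(\<lambda>i. c ^ i) ` {..dimension}. \<forall>\<theta>\<in>S. ?f \<theta> = v"
  proof (rule regular_function_constant_on_irreducible[OF S(1) op_det_weight_stretch_regular])
    show "?f ` S \<subseteq> (\<lambda>i. c ^ i) ` {..dimension}"
      using f dim_subset_UNIV by auto
  qed simp
  then have "c ^ dim (weight_space_at \<phi> \<mu>) = c ^ dim (weight_space_at \<psi> \<mu>)"
    using f S(2,3) by metis
  then show ?thesis
    using inj_onD[OF c] dim_subset_UNIV by simp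
qed

lemma weight_space_inclusion: "weight_space_at (inclusion t) \<mu> = weight_space (*s) act t \<mu>"
  by (simp add: weight_space_def inclusion_def)

lemma inclusion_hom: "inclusion t \<in> homs"
  using G.subspace_add[OF subspace_t] G.subspace_scale[OF subspace_t] G.subspace_0[OF subspace_t]
  by (auto simp: rlie_homs_def linear_maps_on_def inclusion_def brk_t pmap_t)

section \<open>Weight spaces relative to the torus\<close>

text \<open>
  The weights are exactly the weights of the members of a basis of weight vectors, hence finite in number.
\<close>

lemma weight_space_decomposition:
  "is_direct_sum (weights g (*s) act t) (weight_space (*s) act t)"
proof -
  obtain B \<nu> where B: "independent B" "span B = UNIV"
    and \<nu>: "\<And>b. b \<in> B \<Longrightarrow> \<nu> b \<in> linear_forms \<and> b \<in> weight_space_at (inclusion t) (\<nu> b)"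
    using weight_basis_exists[OF inclusion_hom] by blast
  have V: "weight_space (*s) act t \<mu> = span {b \<in> B. \<nu> b = \<mu>}" if "\<mu> \<in> linear_forms" for \<mu>
    using weight_space_eq_span[OF B \<nu> that] by (simp add: weight_space_inclusion)
  have "weights g (*s) act t = \<nu> ` B"
  proof (intro equalityI subsetI)
    fix \<mu> assume "\<mu> \<in> weights g (*s) act t"
    then have "span {b \<in> B. \<nu> b = \<mu>} \<noteq> {0}"
      using V by (auto simp: weights_def)
    then show "\<mu> \<in> \<nu> ` B"
      by (cases "{b \<in> B. \<nu> b = \<mu>} = {}") auto
  next
    fix \<mu> assume "\<mu> \<in> \<nu> ` B"
    then obtain b where b: "b \<in> B" "\<mu> = \<nu> b"
      by blast
    then have "b \<noteq> 0"
      using B(1) dependent_zero by blast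
    moreover have "b \<in> weight_space (*s) act t \<mu>"
      using \<nu>[OF b(1)] b(2) by (simp add: weight_space_inclusion)
    ultimately show "\<mu> \<in> weights g (*s) act t"
      using \<nu>[OF b(1)] b(2) by (auto simp: weights_def)
  qed
  then show ?thesis
    using V \<nu> finiteI_independent[OF B(1)] by (intro direct_sum_of_spans[OF B, of _ \<nu>]) auto
qed

lemma weights_subset_toral_forms: "weights g (*s) act t \<subseteq> toral_forms g t"
proof
  fix \<mu> assume \<mu>: "\<mu> \<in> weights g (*s) act t"
  then have form: "\<mu> \<in> linear_forms"
    by (simp add: weights_def)
  obtain m where m: "m \<noteq> 0" "m \<in> weight_space (*s) act t \<mu>"
    using \<mu> subspace_0[OF subspace_weight_space[of id t \<mu>]] by (auto simp: weights_def)
  have "\<mu> (pmap g x) = \<mu> x ^ CHAR('k)" if x: "x \<in> t" for x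
  proof -
    have "(act x ^^ n) m = (\<mu> x ^ n) *s m" for n
      using m(2) x by (induction n)
        (simp_all add: weight_space_def pair.linear_scale[OF act_endo] mult.commute)
    then have "act (pmap g x) m = (\<mu> x ^ CHAR('k)) *s m"
      by (simp add: act_pmap)
    moreover have "act (pmap g x) m = \<mu> (pmap g x) *s m"
      using m(2) pmap_t[OF x] by (simp add: weight_space_def)
    ultimately show ?thesis
      using m(1) by simp
  qed
  then show "\<mu> \<in> toral_forms g t"
    using form by (simp add: toral_forms_def rlie_homs_def brk_t form_0) (simp add: field_rlie_def)
qed

text \<open>
  The embedding \<open>h \<cdot> inclusion\<close> lies in \<open>X\<close>, and along it \<open>\<mu> \<circ> h\<inverse>\<close> has the same weight space as \<open>\<mu>\<close>
  has along the inclusion, since \<open>x\<close> acts as \<open>h\<inverse> x\<close>.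
\<close>

lemma weight_space_dim_invariant:
  assumes X: "irreducible_subset (zariski g t) X" "inclusion t \<in> X"
    and h: "h \<in> component_stabilizer g t X" and \<mu>: "\<mu> \<in> linear_forms"
  shows "aut_act t h \<mu> \<in> linear_forms"
    and "dim (weight_space (*s) act t (aut_act t h \<mu>)) = dim (weight_space (*s) act t \<mu>)"
proof -
  have hom: "h \<in> homs" and bij: "bij_betw h t t" and stab: "aut_act t h ` X = X"
    using h by (simp_all add: component_stabilizer_def rlie_auts_def)
  let ?k = "inv_into t h"
  have k: "?k x \<in> t" "h (?k x) = x" "?k (h x) = x" "h x \<in> t" if "x \<in> t" for x
    using that bij bij_betw_inv_into[OF bij]
    by (auto simp: bij_betw_inv_into_left bij_betw_inv_into_right dest: bij_betwE)
  have k_add: "?k (x + y) = ?k x + ?k y" if "x \<in> t" "y \<in> t" for x y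
    using hom_add[OF hom k(1)[OF that(1)] k(1)[OF that(2)]] that
      k(3)[OF G.subspace_add[OF subspace_t k(1)[OF that(1)] k(1)[OF that(2)]]]
    by (simp add: k)
  have k_scl: "?k (scl g c x) = scl g c (?k x)" if "x \<in> t" for c x
    using hom_scl[OF hom k(1)[OF that]] k(3)[OF G.subspace_scale[OF subspace_t k(1)[OF that]]] that
    by (simp add: k)
  show form: "aut_act t h \<mu> \<in> linear_forms"
    using \<mu> G.subspace_add[OF subspace_t] G.subspace_scale[OF subspace_t]
    by (auto simp: linear_maps_on_def aut_act_def k_add k_scl k(1) field_rlie_def)
  let ?\<phi> = "aut_act t h (inclusion t)"
  have "weight_space_at ?\<phi> (aut_act t h \<mu>) = weight_space (*s) act t \<mu>"
  proof -
    have "(\<forall>x\<in>t. act (?k x) m = \<mu> (?k x) *s m) \<longleftrightarrow> (\<forall>x\<in>t. act x m = \<mu> x *s m)" for m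
      using k by metis
    then show ?thesis
      by (simp add: weight_space_def aut_act_def inclusion_def k(1))
  qed
  moreover have "?\<phi> \<in> X"
    using stab X(2) by blast
  ultimately show "dim (weight_space (*s) act t (aut_act t h \<mu>)) = dim (weight_space (*s) act t \<mu>)"
    using dim_weight_space_constant[OF X(1) _ X(2) form, of ?\<phi>] by (simp add: weight_space_inclusion)
qed

end

theorem theorem6p1p1:
  fixes g :: "('k::alg_closed_field, 'g::ab_group_add) rlie"
    and t :: "'g set"
    and X :: "('g \<Rightarrow> 'g) set"
    and sM :: "'k \<Rightarrow> 'm::ab_group_add \<Rightarrow> 'm"
    and act :: "'g \<Rightarrow> 'm \<Rightarrow> 'm"
  assumes "CHAR('k) \<ge> 3"
    and "restricted_lie_algebra g"
    and "\<exists>B. finite_dimensional_vector_space (scl g) B"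
    and "torus g t"
    and "vector_space.dim (scl g) t = max_torus_dim g"
    and "irreducible_component (zariski g t) X"
    and "inclusion t \<in> X"
    and "restricted_module g sM act"
    and "\<exists>B. finite_dimensional_vector_space sM B"
  shows "is_direct_sum (weights g sM act t) (weight_space sM act t) \<and>
    weights g sM act t \<subseteq> toral_forms g t \<and>
    (\<forall>h \<in> component_stabilizer g t X. \<forall>\<mu> \<in> weights g sM act t.
       aut_act t h \<mu> \<in> weights g sM act t \<and>
       vector_space.dim sM (weight_space sM act t (aut_act t h \<mu>)) =
         vector_space.dim sM (weight_space sM act t \<mu>))"
proof -
  obtain BG where "finite_dimensional_vector_space (scl g) BG"
    using assms(3) by blast
  then interpret G: finite_dimensional_vector_space "scl g" BG .
  obtain Y where Y: "Y \<subseteq> t" "G.independent Y" "t \<subseteq> G.span Y"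
    using G.maximal_independent_subset by blast
  obtain ys where ys: "set ys = Y"
    using finite_list[OF G.finiteI_independent[OF Y(2)]] by blast
  obtain BM where "finite_dimensional_vector_space sM BM"
    using assms(9) by blast
  then interpret M: finite_dimensional_vector_space sM BM .
  interpret torus_module sM BM g t act ys
    using assms Y ys by unfold_locales simp_all
  have X: "irreducible_subset (zariski g t) X"
    using assms(6) by (simp add: irreducible_component_def)
  have "aut_act t h \<mu> \<in> weights g sM act t \<and>
      M.dim (weight_space sM act t (aut_act t h \<mu>)) = M.dim (weight_space sM act t \<mu>)"
    if h: "h \<in> component_stabilizer g t X" and \<mu>: "\<mu> \<in> weights g sM act t" for h \<mu>
  proof -
    have form: "\<mu> \<in> linear_maps_on g t field_rlie"
      and nz: "weight_space sM act t \<mu> \<noteq> {0}"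
      using \<mu> by (simp_all add: weights_def)
    note inv = weight_space_dim_invariant[OF X assms(7) h form]
    obtain m where "m \<in> weight_space sM act t \<mu>" "m \<noteq> 0"
      using nz M.subspace_0[OF subspace_weight_space[of id t \<mu>]] by auto
    then have "\<not> weight_space sM act t \<mu> \<subseteq> {0}"
      by auto
    then have "M.dim (weight_space sM act t \<mu>) \<noteq> 0"
      by simp
    then have "\<not> weight_space sM act t (aut_act t h \<mu>) \<subseteq> {0}"
      using inv(2) by (metis M.dim_eq_0)
    with inv show ?thesis
      by (auto simp: weights_def)
  qed
  then show ?thesis
    using weight_space_decomposition weights_subset_toral_forms by blast
qed

end
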